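(* Let $M=(G;r_0,r_1,r_2)$ be a regular polyhedron whose underlying graph is simple. Then $(G;r_0,r_1,r_2)$ satisfies the conditions of a regular linear hypermap and $\mathcal M^{\mathrm{dig}}=\mathcal M(G;r_0,r_1,r_2)$ is the regular digon linear hypermap of $M$, and $(G;r_1,r_0,r_2)$ satisfies the conditions of a regular linear hypermap and $\mathcal M^{\mathrm{med}}=\mathcal M(G;r_1,r_0,r_2)$ is the regular medial linear hypermap of $M$.
   Context: A regular polyhedron (regular map) $M=(G;r_0,r_1,r_2)$ is a map on a closed surface whose automorphism group $G$ acts regularly on its flags (incident vertex-edge-face triples), where $G$ is generated by involutions $r_0,r_1,r_2$ such that, for a fixed base flag, $\langle r_1,r_2\rangle$ is the stabilizer of its vertex, $\langle r_0,r_2\rangle$ (a Klein four-group, $(r_0r_2)^2=1$) is the stabilizer of its edge, and $\langle r_0,r_1\rangle$ is the stabilizer of its face. For a finite group $G$ and pairwise distinct involutions $s_0,s_1,s_2$ generating $G$, $\mathcal M(G;s_0,s_1,s_2)$ is a regular linear hypermap if (1) $\langle s_1,s_2\rangle\cap\langle s_0,s_2\rangle=\langle s_2\rangle$ and (2) $\langle s_1,s_2\rangle\langle s_0,s_2\rangle\cap\langle s_0,s_2\rangle\langle s_1,s_2\rangle=\langle s_1,s_2\rangle\cup\langle s_0,s_2\rangle$; its vertices, hyperedges and hyperfaces correspond to the cosets of $\langle s_1,s_2\rangle$, $\langle s_0,s_2\rangle$, $\langle s_0,s_1\rangle$, with incidence given by nonempty intersection. For a map $M$ with simple underlying graph: the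 digon linear hypermap $\mathcal M^{\mathrm{dig}}$ of $M$ is obtained by replacing each edge of $M$ with a digon (two parallel edges bounding a 2-cell); its hyperedges are the digons and its hyperfaces are the faces of $M$. Two edges of $M$ are contiguous if they are consecutive around some corner (vertex-face incidence); the medial map $M^{\mathrm{med}}$ has vertex set the edges of $M$, two being adjacent when contiguous. A linear hypermap $\mathcal M^{\mathrm{med}}$ is the medial linear hypermap of $M$ if its associated map (the embedding of its underlying graph whose faces are the hyperedges and hyperfaces) is $M^{\mathrm{med}}$ and its hyperedges and hyperfaces correspond naturally to the vertices and faces of $M$, respectively. *)

theory Defs
  imports "HOL-Algebra.Generated_Groups" "HOL-Algebra.Bij"
begin

section \<open>Maps and hypermaps as flag systems\<close>

text \<open>
  A cellular decomposition of a closed surface is encoded by the flags of its barycentric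
  subdivision (called blades here) together with the three adjacency involutions:
  \<open>adj X i\<close> moves a blade to the neighbouring one across the side that
  changes the cell of dimension \<open>i\<close> and keeps the other two.
  Cells are orbits: vertices of the subgroup generated by \<open>adj 1, adj 2\<close>, (hyper)edges of
  \<open>adj 0, adj 2\<close>, (hyper)faces of \<open>adj 0, adj 1\<close>.  Two cells are incident when they
  share a blade.  Values of \<open>adj\<close> at indices other than 0, 1, 2 are irrelevant.
\<close>

record 'b flag_system =
  blades :: "'b set"
  adj :: "nat \<Rightarrow> 'b \<Rightarrow> 'b"

definition orbit :: "('b, 'z) flag_system_scheme \<Rightarrow> nat set \<Rightarrow> 'b \<Rightarrow> 'b set" where
  "orbit X I b = {c. (b, c) \<in> {(x, adj X i x) | x i. x \<in> blades X \<and> i \<in> I}\<^sup>*}"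

abbreviation "vertex_of X \<equiv> orbit X {1, 2}"
abbreviation "edge_of X \<equiv> orbit X {0, 2}"
abbreviation "face_of X \<equiv> orbit X {0, 1}"

abbreviation "vertices X \<equiv> vertex_of X ` blades X"
abbreviation "edges X \<equiv> edge_of X ` blades X"
abbreviation "faces X \<equiv> face_of X ` blades X"

abbreviation "hyperedges X \<equiv> edges X"
abbreviation "hyperfaces X \<equiv> faces X"

definition incident :: "'b set \<Rightarrow> 'b set \<Rightarrow> bool" where
  "incident x y \<longleftrightarrow> x \<inter> y \<noteq> {}"

text \<open>A finite connected hypermap without boundary.\<close>

definition hypermap :: "('b, 'z) flag_system_scheme \<Rightarrow> bool" where
  "hypermap X \<longleftrightarrow>
     finite (blades X) \<and> blades X \<noteq> {} \<and>
     (\<forall>i\<in>{0, 1, 2}. \<forall>b\<in>blades X.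
        adj X i b \<in> blades X \<and> adj X i b \<noteq> b \<and> adj X i (adj X i b) = b) \<and>
     (\<forall>b\<in>blades X. orbit X {0, 1, 2} b = blades X)"

text \<open>
  A map on a closed surface: moreover every edge carries exactly four blades (two ends, two sides).
\<close>

definition surface_map :: "('b, 'z) flag_system_scheme \<Rightarrow> bool" where
  "surface_map M \<longleftrightarrow> hypermap M \<and>
     (\<forall>b\<in>blades M. adj M 0 (adj M 2 b) = adj M 2 (adj M 0 b) \<and> adj M 0 b \<noteq> adj M 2 b)"

definition ends :: "('b, 'z) flag_system_scheme \<Rightarrow> 'b set \<Rightarrow> 'b set set" where
  "ends M e = {v \<in> vertices M. incident v e}"

text \<open>No loops and no parallel edges in the underlying graph.\<close>

definition simple_graph :: "('b, 'z) flag_system_scheme \<Rightarrow> bool" where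
  "simple_graph M \<longleftrightarrow> (\<forall>e\<in>edges M. card (ends M e) = 2) \<and> inj_on (ends M) (edges M)"

definition is_iso ::
  "('b, 'z) flag_system_scheme \<Rightarrow> ('c, 'y) flag_system_scheme \<Rightarrow> ('b \<Rightarrow> 'c) \<Rightarrow> bool" where
  "is_iso X Y h \<longleftrightarrow> bij_betw h (blades X) (blades Y) \<and>
     (\<forall>i\<in>{0, 1, 2}. \<forall>b\<in>blades X. h (adj X i b) = adj Y i (h b))"

definition aut_group :: "('b, 'z) flag_system_scheme \<Rightarrow> ('b \<Rightarrow> 'b) monoid" where
  "aut_group X = BijGroup (blades X) \<lparr>carrier := {g \<in> Bij (blades X). is_iso X X g}\<rparr>"


section \<open>Regular polyhedra\<close>

text \<open>The flags of a map are its incident vertex-edge-face triples.\<close>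

definition flags :: "('b, 'z) flag_system_scheme \<Rightarrow> ('b set \<times> 'b set \<times> 'b set) set" where
  "flags M = {(v, e, f). v \<in> vertices M \<and> e \<in> edges M \<and> f \<in> faces M \<and>
                         incident v e \<and> incident e f \<and> incident v f}"

definition move_flag ::
  "('b \<Rightarrow> 'b) \<Rightarrow> 'b set \<times> 'b set \<times> 'b set \<Rightarrow> 'b set \<times> 'b set \<times> 'b set" where
  "move_flag g = (\<lambda>(v, e, f). (g ` v, g ` e, g ` f))"

definition cell_stabilizer :: "('b \<Rightarrow> 'b) monoid \<Rightarrow> 'b set \<Rightarrow> ('b \<Rightarrow> 'b) set" where
  "cell_stabilizer G x = {g \<in> carrier G. g ` x = x}"

definition involution :: "('g, 'm) monoid_scheme \<Rightarrow> 'g \<Rightarrow> bool" where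
  "involution G s \<longleftrightarrow> s \<in> carrier G \<and> s \<noteq> \<one>\<^bsub>G\<^esub> \<and> s \<otimes>\<^bsub>G\<^esub> s = \<one>\<^bsub>G\<^esub>"

text \<open>
  \<open>regular_polyhedron M G r0 r1 r2 b\<close> says that \<open>M = (G; r0, r1, r2)\<close> is a regular polyhedron
  whose distinguished generators belong to the base flag carried by the blade \<open>b\<close>.  The generator
  \<open>r\<^sub>i\<close> is the automorphism that takes the base flag to its \<open>i\<close>-adjacent flag.  The stabilizer
  conditions follow from that; alone they would not always determine \<open>r1\<close> (a vertex may
  occur several times on a face), hence both are recorded.
\<close>

definition regular_polyhedron ::
  "('b, 'z) flag_system_scheme \<Rightarrow> ('b \<Rightarrow> 'b) monoid \<Rightarrow> ('b \<Rightarrow> 'b) \<Rightarrow> ('b \<Rightarrow> 'b) \<Rightarrow> ('b \<Rightarrow> 'b) \<Rightarrow> 'b \<Rightarrow> bool"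
  where
  "regular_polyhedron M G r0 r1 r2 b \<longleftrightarrow>
     surface_map M \<and> G = aut_group M \<and>
     (\<forall>x\<in>flags M. \<forall>y\<in>flags M. \<exists>!g. g \<in> carrier G \<and> move_flag g x = y) \<and>
     involution G r0 \<and> involution G r1 \<and> involution G r2 \<and>
     generate G {r0, r1, r2} = carrier G \<and>
     b \<in> blades M \<and> r0 b = adj M 0 b \<and> r1 b = adj M 1 b \<and> r2 b = adj M 2 b \<and>
     generate G {r1, r2} = cell_stabilizer G (vertex_of M b) \<and>
     generate G {r0, r2} = cell_stabilizer G (edge_of M b) \<and>
     generate G {r0, r1} = cell_stabilizer G (face_of M b) \<and>
     card (generate G {r0, r2}) = 4 \<and> (r0 \<otimes>\<^bsub>G\<^esub> r2) [^]\<^bsub>G\<^esub> (2::nat) = \<one>\<^bsub>G\<^esub>"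


section \<open>Linear hypermaps\<close>

text \<open>
  A linear hypermap is an embedding of a graph, its associated map, whose faces are the
  hyperedges and the hyperfaces, every edge of the graph lying between a hyperedge and a hyperface.
  In terms of a hypermap: the graph edge at a blade is traversed by \<open>adj 0\<close>, each blade
  is split into its half inside the hyperedge and its half inside the hyperface, and turning around
  the vertex inside a hyperedge (hyperface) is \<open>adj 2\<close> (\<open>adj 1\<close>).
\<close>

datatype cell_side = In_Hyperedge | In_Hyperface

fun associated_adj ::
  "('b, 'z) flag_system_scheme \<Rightarrow> nat \<Rightarrow> 'b \<times> cell_side \<Rightarrow> 'b \<times> cell_side" where
  "associated_adj H i (b, In_Hyperedge) =
     (if i = 0 then (adj H 0 b, In_Hyperedge)
      else if i = 1 then (adj H 2 b, In_Hyperedge)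
      else (b, In_Hyperface))"
| "associated_adj H i (b, In_Hyperface) =
     (if i = 0 then (adj H 0 b, In_Hyperface)
      else if i = 1 then (adj H 1 b, In_Hyperface)
      else (b, In_Hyperedge))"

definition associated_map ::
  "('b, 'z) flag_system_scheme \<Rightarrow> ('b \<times> cell_side) flag_system" where
  "associated_map H = \<lparr>blades = blades H \<times> UNIV, adj = associated_adj H\<rparr>"

text \<open>
  The first two conditions say that each hyperedge is bounded by a cycle of the graph (of length 2
  if it is a digon): its boundary has no loops and passes through each of its vertices once.
  The last one is linearity of the hypergraph.
\<close>

definition linear_hypermap :: "('b, 'z) flag_system_scheme \<Rightarrow> bool" where
  "linear_hypermap H \<longleftrightarrow> hypermap H \<and>
     (\<forall>b\<in>blades H. adj H 0 b \<notin> vertex_of H b) \<and>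
     (\<forall>b\<in>blades H. vertex_of H b \<inter> edge_of H b = {b, adj H 2 b}) \<and>
     (\<forall>u\<in>vertices H. \<forall>v\<in>vertices H. \<forall>x\<in>hyperedges H. \<forall>y\<in>hyperedges H.
        u \<noteq> v \<and> incident u x \<and> incident v x \<and> incident u y \<and> incident v y \<longrightarrow> x = y)"

definition regular_hypermap :: "('b, 'z) flag_system_scheme \<Rightarrow> bool" where
  "regular_hypermap H \<longleftrightarrow> hypermap H \<and>
     (\<forall>b\<in>blades H. \<forall>c\<in>blades H. \<exists>!g. g \<in> carrier (aut_group H) \<and> g b = c)"

text \<open>The conditions under which \<open>\<M>(G; s0, s1, s2)\<close> is a regular linear hypermap.\<close>

definition regular_linear_conditions ::
  "('g, 'm) monoid_scheme \<Rightarrow> 'g \<Rightarrow> 'g \<Rightarrow> 'g \<Rightarrow> bool" where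
  "regular_linear_conditions G s0 s1 s2 \<longleftrightarrow>
     group G \<and> finite (carrier G) \<and>
     involution G s0 \<and> involution G s1 \<and> involution G s2 \<and>
     s0 \<noteq> s1 \<and> s0 \<noteq> s2 \<and> s1 \<noteq> s2 \<and>
     generate G {s0, s1, s2} = carrier G \<and>
     generate G {s1, s2} \<inter> generate G {s0, s2} = generate G {s2} \<and>
     (generate G {s1, s2} <#>\<^bsub>G\<^esub> generate G {s0, s2}) \<inter>
     (generate G {s0, s2} <#>\<^bsub>G\<^esub> generate G {s1, s2}) =
       generate G {s1, s2} \<union> generate G {s0, s2}"

text \<open>
  \<open>\<M>(G; s0, s1, s2)\<close>.  The elements of \<open>G\<close> are the blades, and \<open>G\<close> acts by left multiplication.
  By the lemma below the cells are the left cosets of the subgroups generated by two of the \<open>s\<^sub>i\<close>.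
\<close>

definition coset_hypermap ::
  "('g, 'm) monoid_scheme \<Rightarrow> 'g \<Rightarrow> 'g \<Rightarrow> 'g \<Rightarrow> 'g flag_system" where
  "coset_hypermap G s0 s1 s2 =
     \<lparr>blades = carrier G,
      adj = (\<lambda>i g. g \<otimes>\<^bsub>G\<^esub> (if i = 0 then s0 else if i = 1 then s1 else s2))\<rparr>"


section \<open>The digon and the medial linear hypermap of a map\<close>

text \<open>
  Every edge of \<open>M\<close> is replaced by two parallel edges bounding a digon.  Each blade \<open>b\<close> of \<open>M\<close> is cut
  by the new edge on its side into an outer part in the face and an inner part in the
  digon.  Turning around the vertex inside the digon leads to the parallel edge at the other side.
\<close>

datatype digon_side = In_Digon | In_Face

fun digon_adj ::
  "('b, 'z) flag_system_scheme \<Rightarrow> nat \<Rightarrow> 'b \<times> digon_side \<Rightarrow> 'b \<times> digon_side" where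
  "digon_adj M i (b, In_Digon) =
     (if i = 0 then (adj M 0 b, In_Digon)
      else if i = 1 then (adj M 2 b, In_Digon)
      else (b, In_Face))"
| "digon_adj M i (b, In_Face) =
     (if i = 0 then (adj M 0 b, In_Face)
      else if i = 1 then (adj M 1 b, In_Face)
      else (b, In_Digon))"

definition digon_map :: "('b, 'z) flag_system_scheme \<Rightarrow> ('b \<times> digon_side) flag_system" where
  "digon_map M = \<lparr>blades = blades M \<times> UNIV, adj = digon_adj M\<rparr>"

text \<open>The faces of \<^term>\<open>digon_map M\<close> are the digons \<open>e \<times> {In_Digon}\<close> and the faces
  \<open>f \<times> {In_Face}\<close>, for the edges \<open>e\<close> and faces \<open>f\<close> of \<open>M\<close>.\<close>

definition digon_linear_hypermap ::
  "('b, 'z) flag_system_scheme \<Rightarrow> ('c, 'y) flag_system_scheme \<Rightarrow> bool" where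
  "digon_linear_hypermap M H \<longleftrightarrow> linear_hypermap H \<and>
     (\<exists>h. is_iso (associated_map H) (digon_map M) h \<and>
        {h ` (x \<times> {In_Hyperedge}) | x. x \<in> hyperedges H} = {e \<times> {In_Digon} | e. e \<in> edges M} \<and>
        {h ` (y \<times> {In_Hyperface}) | y. y \<in> hyperfaces H} = {f \<times> {In_Face} | f. f \<in> faces M})"

text \<open>
  Two edges are contiguous if they are consecutive around a corner; the corner at a blade
  \<open>b\<close> is \<open>{b, adj M 1 b}\<close>.
\<close>

definition contiguous :: "('b, 'z) flag_system_scheme \<Rightarrow> 'b set \<Rightarrow> 'b set \<Rightarrow> bool" where
  "contiguous M e e' \<longleftrightarrow> (\<exists>b\<in>blades M. b \<in> e \<and> adj M 1 b \<in> e')"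

definition adjacent :: "('b, 'z) flag_system_scheme \<Rightarrow> 'b set \<Rightarrow> 'b set \<Rightarrow> bool" where
  "adjacent M u v \<longleftrightarrow> (\<exists>b\<in>blades M. b \<in> u \<and> adj M 0 b \<in> v)"

text \<open>
  The medial map has a vertex at the midpoint of each edge of \<open>M\<close>, and in each corner of \<open>M\<close> an edge
  joining the midpoints of the two edges of that corner.  This edge cuts a blade \<open>b\<close> into a part near
  its vertex and a part near its face.  Around the midpoint of the edge, the part
  near the vertex adjoins the corresponding part across the edge (\<open>adj M 2\<close>), and the part near the face
  adjoins the one at the other end (\<open>adj M 0\<close>).
\<close>

datatype medial_side = Near_Vertex | Near_Face

fun medial_adj ::
  "('b, 'z) flag_system_scheme \<Rightarrow> nat \<Rightarrow> 'b \<times> medial_side \<Rightarrow> 'b \<times> medial_side" where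
  "medial_adj M i (b, Near_Vertex) =
     (if i = 0 then (adj M 1 b, Near_Vertex)
      else if i = 1 then (adj M 2 b, Near_Vertex)
      else (b, Near_Face))"
| "medial_adj M i (b, Near_Face) =
     (if i = 0 then (adj M 1 b, Near_Face)
      else if i = 1 then (adj M 0 b, Near_Face)
      else (b, Near_Vertex))"

definition medial_map :: "('b, 'z) flag_system_scheme \<Rightarrow> ('b \<times> medial_side) flag_system" where
  "medial_map M = \<lparr>blades = blades M \<times> UNIV, adj = medial_adj M\<rparr>"

definition medial_linear_hypermap ::
  "('b, 'z) flag_system_scheme \<Rightarrow> ('c, 'y) flag_system_scheme \<Rightarrow> bool" where
  "medial_linear_hypermap M H \<longleftrightarrow> linear_hypermap H \<and>
     (\<exists>h. is_iso (associated_map H) (medial_map M) h \<and>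
        {h ` (x \<times> {In_Hyperedge}) | x. x \<in> hyperedges H} =
          {v \<times> {Near_Vertex} | v. v \<in> vertices M} \<and>
        {h ` (y \<times> {In_Hyperface}) | y. y \<in> hyperfaces H} =
          {f \<times> {Near_Face} | f. f \<in> faces M})"


section \<open>The encodings yield the intended cells\<close>

lemma orbit_refl: "b \<in> orbit X I b"
  by (simp add: orbit_def)

lemma orbit_step: "c \<in> orbit X I b \<Longrightarrow> c \<in> blades X \<Longrightarrow> i \<in> I \<Longrightarrow> adj X i c \<in> orbit X I b"
  unfolding orbit_def by (auto intro: rtrancl_into_rtrancl)

lemma orbit_least:
  assumes "b \<in> S" "\<And>c i. c \<in> S \<Longrightarrow> c \<in> blades X \<Longrightarrow> i \<in> I \<Longrightarrow> adj X i c \<in> S"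
  shows "orbit X I b \<subseteq> S"
proof
  fix c assume "c \<in> orbit X I b"
  then have "(b, c) \<in> {(x, adj X i x) | x i. x \<in> blades X \<and> i \<in> I}\<^sup>*"
    by (simp add: orbit_def)
  then show "c \<in> S"
    by (induction rule: rtrancl_induct) (use assms in auto)
qed

lemma orbit_blades:
  assumes "hypermap X" "b \<in> blades X" "I \<subseteq> {0, 1, 2}"
  shows "orbit X I b \<subseteq> blades X"
  by (rule orbit_least) (use assms in \<open>auto simp: hypermap_def\<close>)

lemma orbit_coset_hypermap:
  fixes s0 s1 s2
  defines "s \<equiv> (\<lambda>i::nat. if i = 0 then s0 else if i = 1 then s1 else s2)"
  assumes G: "group G" and s: "involution G s0" "involution G s1" "involution G s2"
    and g: "g \<in> carrier G"
  shows "orbit (coset_hypermap G s0 s1 s2) I g = g <#\<^bsub>G\<^esub> generate G (s ` I)"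
proof -
  interpret group G by (fact G)
  let ?X = "coset_hypermap G s0 s1 s2"
  have sc: "s i \<in> carrier G" and ss: "s i \<otimes>\<^bsub>G\<^esub> s i = \<one>\<^bsub>G\<^esub>" for i
    using s by (auto simp: s_def involution_def)
  have sub: "s ` I \<subseteq> carrier G" using sc by auto
  have adj: "adj ?X i x = x \<otimes>\<^bsub>G\<^esub> s i" for i x
    by (simp add: coset_hypermap_def s_def)
  have bl: "blades ?X = carrier G" by (simp add: coset_hypermap_def)
  have gen: "x \<in> carrier G" if "x \<in> generate G (s ` I)" for x
    using generate_in_carrier[OF sub that] .
  show ?thesis
  proof
    show "orbit ?X I g \<subseteq> g <#\<^bsub>G\<^esub> generate G (s ` I)"
    proof (rule orbit_least)
      show "g \<in> g <#\<^bsub>G\<^esub> generate G (s ` I)"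
        using generate.one[of G] g by (force simp: l_coset_def)
    next
      fix c i assume "c \<in> g <#\<^bsub>G\<^esub> generate G (s ` I)" "i \<in> I"
      then obtain k where k: "k \<in> generate G (s ` I)" "c = g \<otimes>\<^bsub>G\<^esub> k"
        by (auto simp: l_coset_def)
      have "k \<otimes>\<^bsub>G\<^esub> s i \<in> generate G (s ` I)"
        using k \<open>i \<in> I\<close> by (auto intro: generate.eng generate.incl)
      moreover have "adj ?X i c = g \<otimes>\<^bsub>G\<^esub> (k \<otimes>\<^bsub>G\<^esub> s i)"
        using k g gen sc by (simp add: adj m_assoc)
      ultimately show "adj ?X i c \<in> g <#\<^bsub>G\<^esub> generate G (s ` I)"
        by (auto simp: l_coset_def)
    qed
    have "c \<otimes>\<^bsub>G\<^esub> k \<in> orbit ?X I g"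
      if "k \<in> generate G (s ` I)" "c \<in> orbit ?X I g" "c \<in> carrier G" for c k
      using that
    proof (induction k arbitrary: c rule: generate.induct)
      case one then show ?case by simp
    next
      case (incl h)
      then show ?case using orbit_step[of c ?X I g] by (auto simp: adj bl)
    next
      case (inv h)
      then obtain i where i: "i \<in> I" "h = s i" by auto
      then have "inv\<^bsub>G\<^esub> h = s i" using ss sc by (simp add: inv_equality)
      then show ?case using orbit_step[of c ?X I g i] inv i by (auto simp: adj bl)
    next
      case (eng k1 k2)
      have "c \<otimes>\<^bsub>G\<^esub> (k1 \<otimes>\<^bsub>G\<^esub> k2) = (c \<otimes>\<^bsub>G\<^esub> k1) \<otimes>\<^bsub>G\<^esub> k2"
        using eng gen by (simp add: m_assoc)
      then show ?case using eng gen by (metis m_closed)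
    qed
    then show "g <#\<^bsub>G\<^esub> generate G (s ` I) \<subseteq> orbit ?X I g"
      using g by (auto simp: l_coset_def orbit_refl)
  qed
qed

lemma vertex_of_medial_map:
  assumes M: "hypermap M" and b: "b \<in> blades M"
  shows "vertex_of (medial_map M) (b, t) = edge_of M b \<times> UNIV"
proof
  have bl: "edge_of M b \<subseteq> blades M" using orbit_blades[OF M b] by simp
  have *: "x = Near_Vertex \<or> x = Near_Face" for x by (cases x) auto
  show "vertex_of (medial_map M) (b, t) \<subseteq> edge_of M b \<times> UNIV"
  proof (rule orbit_least)
    fix c i assume "c \<in> edge_of M b \<times> (UNIV :: medial_side set)" "i \<in> {1, 2 :: nat}"
    then show "adj (medial_map M) i c \<in> edge_of M b \<times> UNIV"
      using bl by (cases c, cases "snd c")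
        (auto simp: medial_map_def intro!: orbit_step[where X = M])
  qed (simp add: orbit_refl)
  have flip: "(c, u) \<in> vertex_of (medial_map M) (b, t)"
    if "(c, w) \<in> vertex_of (medial_map M) (b, t)" "c \<in> blades M" for c u w
    using orbit_step[OF that(1), of 2] that *[of u] *[of w] by (auto simp: medial_map_def)
  have "edge_of M b \<subseteq> {c. \<forall>u. (c, u) \<in> vertex_of (medial_map M) (b, t)}"
  proof (rule orbit_least)
    show "b \<in> {c. \<forall>u. (c, u) \<in> vertex_of (medial_map M) (b, t)}"
      using flip[OF orbit_refl b] by blast
  next
    fix c i assume c: "c \<in> {c. \<forall>u. (c, u) \<in> vertex_of (medial_map M) (b, t)}"
      "c \<in> blades M" and i: "i \<in> {0, 2 :: nat}"
    have A: "adj M i c \<in> blades M" using M c i by (auto simp: hypermap_def)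
    have "(adj M 2 c, Near_Vertex) \<in> vertex_of (medial_map M) (b, t)"
      using orbit_step[of "(c, Near_Vertex)" "medial_map M" "{1,2}" "(b, t)" 1] c
      by (auto simp: medial_map_def)
    moreover have "(adj M 0 c, Near_Face) \<in> vertex_of (medial_map M) (b, t)"
      using orbit_step[of "(c, Near_Face)" "medial_map M" "{1,2}" "(b, t)" 1] c
      by (auto simp: medial_map_def)
    ultimately show "adj M i c \<in> {c. \<forall>u. (c, u) \<in> vertex_of (medial_map M) (b, t)}"
      using flip A i by blast
  qed
  then show "edge_of M b \<times> UNIV \<subseteq> vertex_of (medial_map M) (b, t)" by blast
qed

lemma adjacent_medial_map:
  "adjacent (medial_map M) (e \<times> UNIV) (e' \<times> UNIV) \<longleftrightarrow> contiguous M e e'"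
proof -
  have "fst (medial_adj M 0 c) = adj M 1 (fst c)" for c
    by (cases c, cases "snd c") auto
  then show ?thesis
    by (fastforce simp: adjacent_def contiguous_def medial_map_def mem_Times_iff)
qed

end

theory Submission
  imports Defs
begin

text \<open>
  The automorphism group acts regularly on the blades, so \<open>g \<mapsto> g b\<close> identifies \<open>\<M>(G; r0, r1, r2)\<close>
  with \<open>M\<close> itself, \<open>\<M>(G; r1, r0, r2)\<close> with \<open>M\<close> after the indices 0 and 1 are exchanged, and the
  required isomorphisms of maps can be read off.  The conditions on the generators are symmetric
  under exchange of the first two.  For the product condition, let \<open>v\<close>, \<open>v'\<close> be the ends of the base
  edge \<open>e\<close>, let \<open>A\<close>, \<open>B\<close> be the stabilizers of \<open>v\<close> and \<open>e\<close>, and let \<open>x\<close> lie in \<open>AB\<close> and in \<open>BA\<close>.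
  Then \<open>x v\<close> and \<open>x\<^sup>-\<^sup>1 v\<close> are ends of \<open>e\<close>.  Either \<open>x\<close> fixes \<open>v\<close>, or it swaps \<open>v\<close> and \<open>v'\<close> and so fixes
  \<open>e\<close>, since the graph is simple.
\<close>

section \<open>Orbits and automorphisms\<close>

lemma hypermap_adj_closed:
  "hypermap X \<Longrightarrow> i \<in> {0, 1, 2} \<Longrightarrow> c \<in> blades X \<Longrightarrow> adj X i c \<in> blades X"
  unfolding hypermap_def by blast

lemma hypermap_adj_adj:
  "hypermap X \<Longrightarrow> i \<in> {0, 1, 2} \<Longrightarrow> c \<in> blades X \<Longrightarrow> adj X i (adj X i c) = c"
  unfolding hypermap_def by blast

lemma orbit_trans:
  "c \<in> orbit X I b \<Longrightarrow> d \<in> orbit X I c \<Longrightarrow> d \<in> orbit X I b"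
  unfolding orbit_def by (auto intro: rtrancl_trans)

text \<open>Orbits are built from directed steps, but a step along \<open>adj X i\<close> is undone
  by the same step, since adjacencies are involutions.\<close>

lemma orbit_sym:
  assumes X: "hypermap X" and I: "I \<subseteq> {0, 1, 2}" and b: "b \<in> blades X"
    and c: "c \<in> orbit X I b"
  shows "b \<in> orbit X I c"
proof -
  have "orbit X I b \<subseteq> {c \<in> blades X. b \<in> orbit X I c}"
  proof (rule orbit_least)
    fix c i assume c: "c \<in> {c \<in> blades X. b \<in> orbit X I c}" and i: "i \<in> I"
    then have i': "i \<in> {0, 1, 2}" using I by blast
    have A: "adj X i c \<in> blades X" using hypermap_adj_closed[OF X i'] c by blast
    have "adj X i (adj X i c) \<in> orbit X I (adj X i c)"
      by (rule orbit_step[OF orbit_refl A i])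
    then have "c \<in> orbit X I (adj X i c)" using hypermap_adj_adj[OF X i'] c by simp
    with A c show "adj X i c \<in> {c \<in> blades X. b \<in> orbit X I c}"
      by (auto intro: orbit_trans)
  qed (simp add: b orbit_refl)
  with c show ?thesis by blast
qed

lemma orbit_eq:
  assumes "hypermap X" "I \<subseteq> {0, 1, 2}" "b \<in> blades X" "c \<in> orbit X I b"
  shows "orbit X I c = orbit X I b"
  using orbit_sym[OF assms] orbit_trans assms(4) by (metis subsetI subset_antisym)

lemma orbit_eq_iff_meet:
  assumes X: "hypermap X" and I: "I \<subseteq> {0, 1, 2}" and b: "b \<in> blades X" and c: "c \<in> blades X"
  shows "orbit X I b \<inter> orbit X I c \<noteq> {} \<longleftrightarrow> orbit X I b = orbit X I c"
  using orbit_eq[OF X I b] orbit_eq[OF X I c] orbit_refl[of b X I] by blast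

text \<open>The renaming \<open>\<sigma>\<close> of the indices is needed for the medial hypermap, which exchanges 0 and 1.\<close>

lemma image_orbit:
  assumes closed: "\<And>i x. i \<in> I \<Longrightarrow> x \<in> blades X \<Longrightarrow> adj X i x \<in> blades X"
    and into: "\<And>x. x \<in> blades X \<Longrightarrow> h x \<in> blades Y"
    and equivariant: "\<And>i x. i \<in> I \<Longrightarrow> x \<in> blades X \<Longrightarrow> h (adj X i x) = adj Y (\<sigma> i) (h x)"
    and x: "x \<in> blades X"
  shows "h ` orbit X I x = orbit Y (\<sigma> ` I) (h x)"
proof
  have "orbit X I x \<subseteq> {y \<in> blades X. h y \<in> orbit Y (\<sigma> ` I) (h x)}"
    by (rule orbit_least) (auto simp: x orbit_refl closed equivariant into intro!: orbit_step)
  then show "h ` orbit X I x \<subseteq> orbit Y (\<sigma> ` I) (h x)" by blast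
  have "orbit X I x \<subseteq> blades X"
    by (rule orbit_least) (auto simp: x closed)
  then show "orbit Y (\<sigma> ` I) (h x) \<subseteq> h ` orbit X I x"
  proof (intro orbit_least)
    fix c j assume "c \<in> h ` orbit X I x" "j \<in> \<sigma> ` I"
    then obtain y i where y: "y \<in> orbit X I x" "c = h y" and i: "i \<in> I" "j = \<sigma> i" by blast
    then have "y \<in> blades X" using \<open>orbit X I x \<subseteq> blades X\<close> by blast
    then have "adj Y j c = h (adj X i y)" "adj X i y \<in> orbit X I x"
      using y i by (auto simp: equivariant intro: orbit_step)
    then show "adj Y j c \<in> h ` orbit X I x" by blast
  qed (simp add: orbit_refl)
qed

section \<open>The automorphism group of a hypermap and its action on cells\<close>

lemma carrier_aut_group: "carrier (aut_group X) = {g \<in> Bij (blades X). is_iso X X g}"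
  by (simp add: aut_group_def)

lemma aut_group_adj:
  "g \<in> carrier (aut_group X) \<Longrightarrow> i \<in> {0, 1, 2} \<Longrightarrow> c \<in> blades X \<Longrightarrow>
    g (adj X i c) = adj X i (g c)"
  unfolding carrier_aut_group is_iso_def by blast

lemma aut_group_closed:
  "g \<in> carrier (aut_group X) \<Longrightarrow> c \<in> blades X \<Longrightarrow> g c \<in> blades X"
  unfolding carrier_aut_group is_iso_def bij_betw_def by blast

lemma aut_group_mult_apply:
  "g \<in> carrier (aut_group X) \<Longrightarrow> h \<in> carrier (aut_group X) \<Longrightarrow> c \<in> blades X \<Longrightarrow>
    (g \<otimes>\<^bsub>aut_group X\<^esub> h) c = g (h c)"
  by (simp add: aut_group_def BijGroup_def compose_def)

lemma aut_group_one_apply: "c \<in> blades X \<Longrightarrow> \<one>\<^bsub>aut_group X\<^esub> c = c"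
  by (simp add: aut_group_def BijGroup_def)

lemma aut_groupI:
  assumes "bij_betw g (blades X) (blades X)" "g \<in> extensional (blades X)"
    and "\<And>i c. i \<in> {0, 1, 2} \<Longrightarrow> c \<in> blades X \<Longrightarrow> g (adj X i c) = adj X i (g c)"
  shows "g \<in> carrier (aut_group X)"
  using assms by (auto simp: carrier_aut_group is_iso_def Bij_def)

text \<open>The group laws come from \<open>BijGroup\<close>, so it suffices that the
  adjacency-preserving bijections form a subgroup.\<close>

lemma group_aut_group:
  assumes X: "hypermap X"
  shows "group (aut_group X)"
proof -
  interpret B: group "BijGroup (blades X)" by (rule group_BijGroup)
  let ?H = "carrier (aut_group X)"
  have HB: "?H \<subseteq> Bij (blades X)" by (auto simp: carrier_aut_group)
  have "subgroup ?H (BijGroup (blades X))"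
  proof (rule B.subgroupI)
    show "?H \<subseteq> carrier (BijGroup (blades X))" using HB by (simp add: BijGroup_def)
    have "(\<lambda>c\<in>blades X. c) \<in> ?H"
      using hypermap_adj_closed[OF X] by (intro aut_groupI) (auto simp: bij_betw_def inj_on_def)
    then show "?H \<noteq> {}" by blast
  next
    fix g assume g: "g \<in> ?H"
    then have gB: "g \<in> Bij (blades X)" using HB by blast
    then have bij: "bij_betw g (blades X) (blades X)" by (simp add: Bij_def)
    \<comment> \<open>Elements of \<open>Bij\<close> are extensional, so the inverse has to be
      restricted to the blades.\<close>
    let ?k = "\<lambda>c\<in>blades X. inv_into (blades X) g c"
    have k: "?k \<in> Bij (blades X)" by (rule restrict_inv_into_Bij[OF gB])
    have "?k \<in> ?H"
    proof (rule aut_groupI)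
      fix i c assume i: "i \<in> {0, 1, 2::nat}" and c: "c \<in> blades X"
      let ?d = "inv_into (blades X) g c"
      have d: "?d \<in> blades X" "g ?d = c"
        using bij c by (metis bij_betw_def inv_into_into, metis bij_betw_inv_into_right)
      have "g (adj X i ?d) = adj X i c" using aut_group_adj[OF g i d(1)] d by simp
      then have "inv_into (blades X) g (adj X i c) = adj X i ?d"
        using bij_betw_inv_into_left[OF bij] hypermap_adj_closed[OF X i d(1)] by metis
      then show "?k (adj X i c) = adj X i (?k c)"
        using c hypermap_adj_closed[OF X i c] by simp
    qed (use k in \<open>auto simp: Bij_def\<close>)
    then show "inv\<^bsub>BijGroup (blades X)\<^esub> g \<in> ?H" by (simp add: inv_BijGroup[OF gB])
  next
    fix g h assume g: "g \<in> ?H" and h: "h \<in> ?H"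
    then have "compose (blades X) g h \<in> Bij (blades X)" using HB by (blast intro: compose_Bij)
    then have "compose (blades X) g h \<in> ?H"
      using g h by (intro aut_groupI)
        (auto simp: Bij_def compose_def aut_group_adj aut_group_closed hypermap_adj_closed[OF X])
    then show "g \<otimes>\<^bsub>BijGroup (blades X)\<^esub> h \<in> ?H"
      using g h HB by (auto simp: BijGroup_def)
  qed
  from B.subgroup_imp_group[OF this] show ?thesis
    by (simp add: aut_group_def)
qed

text \<open>The blades on which \<open>f\<close> and \<open>g\<close> agree are closed under all
  adjacencies, so by connectedness one common value forces agreement on every blade; off the blades
  both are \<open>undefined\<close>. Thus the action on blades is free.\<close>

lemma aut_group_eqI:
  assumes X: "hypermap X" and f: "f \<in> carrier (aut_group X)" and g: "g \<in> carrier (aut_group X)"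
    and c: "c \<in> blades X" and eq: "f c = g c"
  shows "f = g"
proof -
  have "orbit X {0, 1, 2} c \<subseteq> {d \<in> blades X. f d = g d}"
    by (rule orbit_least)
      (use c eq in \<open>auto simp: aut_group_adj[OF f] aut_group_adj[OF g] hypermap_adj_closed[OF X]\<close>)
  moreover have "orbit X {0, 1, 2} c = blades X" using X c by (simp add: hypermap_def)
  ultimately have "f d = g d" if "d \<in> blades X" for d using that by blast
  moreover have "f \<in> extensional (blades X)" "g \<in> extensional (blades X)"
    using f g by (auto simp: carrier_aut_group Bij_def)
  ultimately show ?thesis by (rule extensionalityI[rotated 2])
qed

lemma aut_group_image_orbit:
  assumes X: "hypermap X" and I: "I \<subseteq> {0, 1, 2}" and g: "g \<in> carrier (aut_group X)"
    and c: "c \<in> blades X"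
  shows "g ` orbit X I c = orbit X I (g c)"
proof -
  have "g ` orbit X I c = orbit X (id ` I) (g c)"
    using I by (intro image_orbit)
      (auto simp: c aut_group_closed[OF g] intro!: hypermap_adj_closed[OF X] aut_group_adj[OF g])
  then show ?thesis by simp
qed


section \<open>Coset hypermaps\<close>

lemma blades_coset_hypermap [simp]: "blades (coset_hypermap G s0 s1 s2) = carrier G"
  by (simp add: coset_hypermap_def)

lemma adj_coset_hypermap:
  "adj (coset_hypermap G s0 s1 s2) i g =
    g \<otimes>\<^bsub>G\<^esub> (if i = 0 then s0 else if i = 1 then s1 else s2)"
  by (simp add: coset_hypermap_def)

text \<open>The exchange swaps the subgroups \<open>generate G {s1, s2}\<close> and
  \<open>generate G {s0, s2}\<close>, and both the intersection and the product condition are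
  symmetric in them. This yields the conditions for the medial hypermap from those for the digon
  hypermap.\<close>

lemma regular_linear_conditions_swap:
  assumes "regular_linear_conditions G s0 s1 s2"
  shows "regular_linear_conditions G s1 s0 s2"
  using assms unfolding regular_linear_conditions_def
  by (auto simp: insert_commute Int_commute Un_commute)

lemma (in group) generate_involution:
  assumes s: "involution G s"
  shows "generate G {s} = {\<one>, s}"
proof
  have sc: "s \<in> carrier G" and ss: "s \<otimes> s = \<one>" using s by (auto simp: involution_def)
  have "inv s = s" using ss sc by (simp add: inv_equality)
  have "x \<in> {\<one>, s}" if "x \<in> generate G {s}" for x
    using that by (induction rule: generate.induct) (auto simp: \<open>inv s = s\<close> sc ss)
  then show "generate G {s} \<subseteq> {\<one>, s}" by blast
  show "{\<one>, s} \<subseteq> generate G {s}" by (auto intro: generate.one generate.incl)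
qed

text \<open>Adjacencies are right multiplications, so connectedness amounts to generation of
  \<open>G\<close>, and the absence of fixed blades to the generators being nontrivial.\<close>

lemma hypermap_coset_hypermap:
  assumes G: "group G" and fin: "finite (carrier G)"
    and s: "involution G s0" "involution G s1" "involution G s2"
    and gen: "generate G {s0, s1, s2} = carrier G"
  shows "hypermap (coset_hypermap G s0 s1 s2)"
proof -
  interpret group G by fact
  define s where "s = (\<lambda>i::nat. if i = 0 then s0 else if i = 1 then s1 else s2)"
  have sc: "s i \<in> carrier G" "s i \<noteq> \<one>\<^bsub>G\<^esub>" "s i \<otimes>\<^bsub>G\<^esub> s i = \<one>\<^bsub>G\<^esub>" for i
    using s by (auto simp: s_def involution_def)
  have adj: "adj (coset_hypermap G s0 s1 s2) i g = g \<otimes>\<^bsub>G\<^esub> s i" for i g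
    by (simp add: adj_coset_hypermap s_def)
  have "g <#\<^bsub>G\<^esub> carrier G = carrier G" if "g \<in> carrier G" for g
    using coset_join3[OF that subgroup_self that] .
  then have "orbit (coset_hypermap G s0 s1 s2) {0, 1, 2} g = carrier G" if "g \<in> carrier G" for g
    using that gen by (simp add: orbit_coset_hypermap[OF G s] insert_commute)
  moreover have "g \<otimes>\<^bsub>G\<^esub> s i \<noteq> g" if "g \<in> carrier G" for g i
    using that sc[of i] by simp
  ultimately show ?thesis
    unfolding hypermap_def adj using fin sc by (auto simp: m_assoc)
qed

section \<open>Regularity and linearity of the coset hypermap\<close>

text \<open>Left multiplications commute with the right multiplications defining the adjacencies,
  and they are transitive on \<open>G\<close>. Uniqueness holds because one value determines an
  automorphism.\<close>

lemma regular_hypermap_coset_hypermap: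
  assumes "regular_linear_conditions G s0 s1 s2"
  shows "regular_hypermap (coset_hypermap G s0 s1 s2)"
proof -
  let ?H = "coset_hypermap G s0 s1 s2"
  interpret group G using assms by (simp add: regular_linear_conditions_def)
  have H: "hypermap ?H"
    using assms by (intro hypermap_coset_hypermap) (auto simp: regular_linear_conditions_def)
  have s: "s0 \<in> carrier G" "s1 \<in> carrier G" "s2 \<in> carrier G"
    using assms by (auto simp: regular_linear_conditions_def involution_def)
  have "\<exists>!g. g \<in> carrier (aut_group ?H) \<and> g x = y" if x: "x \<in> carrier G" and y: "y \<in> carrier G" for x y
  proof (rule ex_ex1I)
    let ?a = "y \<otimes>\<^bsub>G\<^esub> inv\<^bsub>G\<^esub> x"
    let ?g = "\<lambda>c\<in>carrier G. ?a \<otimes>\<^bsub>G\<^esub> c"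
    have a: "?a \<in> carrier G" using x y by simp
    have "bij_betw ?g (carrier G) (carrier G)"
      by (rule bij_betw_byWitness[where f' = "\<lambda>c. inv\<^bsub>G\<^esub> ?a \<otimes>\<^bsub>G\<^esub> c"])
        (use a in \<open>auto simp: m_assoc[symmetric]\<close>)
    then have "?g \<in> carrier (aut_group ?H)"
      by (intro aut_groupI) (use a s in \<open>auto simp: adj_coset_hypermap m_assoc\<close>)
    moreover have "?g x = y" using x y by (simp add: m_assoc)
    ultimately show "\<exists>g. g \<in> carrier (aut_group ?H) \<and> g x = y" by blast
  next
    fix f g assume "f \<in> carrier (aut_group ?H) \<and> f x = y" "g \<in> carrier (aut_group ?H) \<and> g x = y"
    then show "f = g" using aut_group_eqI[OF H, of f g x] x by simp
  qed
  with H show ?thesis by (simp add: regular_hypermap_def)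
qed

text \<open>Translates incidences of cosets into memberships of quotients in a subgroup, the form to
  which the product condition applies.\<close>

lemma (in group) l_coset_meet_witness:
  assumes A: "subgroup A G" and g: "g \<in> carrier G" and p: "p \<in> g <# A" and q: "q \<in> g <# A"
  shows "inv p \<otimes> q \<in> A"
proof -
  have Ac: "A \<subseteq> carrier G" using A by (rule subgroup.subset)
  obtain a a' where a: "a \<in> A" "p = g \<otimes> a" "a' \<in> A" "q = g \<otimes> a'"
    using p q by (auto simp: l_coset_def)
  then have c: "a \<in> carrier G" "a' \<in> carrier G" using Ac by auto
  have "inv p \<otimes> q = inv a \<otimes> (inv g \<otimes> (g \<otimes> a'))"
    unfolding a using c g by (simp add: inv_mult_group m_assoc)
  also have "\<dots> = inv a \<otimes> a'" using c g by (simp flip: m_assoc)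
  finally show ?thesis
    using a A by (simp add: subgroup.m_closed subgroup.m_inv_closed)
qed

text \<open>The intersection condition gives the two requirements on the boundary of a hyperedge.
  The product condition gives linearity: two vertices on two common hyperedges form a 4-cycle of
  incidences, and the quotient of opposite corners lies in both products.\<close>

lemma linear_hypermap_coset_hypermap:
  assumes C: "regular_linear_conditions G s0 s1 s2"
  shows "linear_hypermap (coset_hypermap G s0 s1 s2)"
proof -
  let ?H = "coset_hypermap G s0 s1 s2"
  interpret group G using C by (simp add: regular_linear_conditions_def)
  let ?A = "generate G {s1, s2}" and ?B = "generate G {s0, s2}"
  have inv: "involution G s0" "involution G s1" "involution G s2"
    and dist: "s0 \<noteq> s1" "s0 \<noteq> s2" "s1 \<noteq> s2"
    and AB: "?A \<inter> ?B = generate G {s2}"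
    and prod: "(?A <#>\<^bsub>G\<^esub> ?B) \<inter> (?B <#>\<^bsub>G\<^esub> ?A) = ?A \<union> ?B"
    using C unfolding regular_linear_conditions_def by blast+
  have sc: "s0 \<in> carrier G" "s1 \<in> carrier G" "s2 \<in> carrier G" and s0: "s0 \<noteq> \<one>\<^bsub>G\<^esub>"
    using inv by (auto simp: involution_def)
  have H: "hypermap ?H"
    using C by (intro hypermap_coset_hypermap) (auto simp: regular_linear_conditions_def)
  have sub: "subgroup ?A G" "subgroup ?B G" using sc by (auto intro: generate_is_subgroup)
  have subc: "?A \<subseteq> carrier G" "?B \<subseteq> carrier G" using sub subgroup.subset by blast+
  have vertex: "vertex_of ?H g = g <#\<^bsub>G\<^esub> ?A" and edge: "edge_of ?H g = g <#\<^bsub>G\<^esub> ?B"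
    if "g \<in> carrier G" for g
    using that by (simp_all add: orbit_coset_hypermap[OF is_group inv] insert_commute)
  have mem: "g \<otimes>\<^bsub>G\<^esub> k \<in> g <#\<^bsub>G\<^esub> K \<longleftrightarrow> k \<in> K"
    if "g \<in> carrier G" "k \<in> carrier G" "K \<subseteq> carrier G" for g k K
    using that by (auto simp: l_coset_def subset_iff)
  have s2: "generate G {s2} = {\<one>\<^bsub>G\<^esub>, s2}" by (rule generate_involution[OF inv(3)])
  \<comment> \<open>If \<open>s0\<close> were also in \<open>?A\<close>, the intersection condition
    would make it the identity or \<open>s2\<close>.\<close>
  have "s0 \<in> ?B" by (auto intro: generate.incl)
  then have "s0 \<notin> ?A" using AB s2 s0 dist by blast
  then have no_loop: "adj ?H 0 g \<notin> vertex_of ?H g" if "g \<in> carrier G" for g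
    using that sc subc by (simp add: vertex mem adj_coset_hypermap del: One_nat_def)
  have inter: "vertex_of ?H g \<inter> edge_of ?H g = {g, adj ?H 2 g}" if g: "g \<in> carrier G" for g
  proof -
    have "(g <#\<^bsub>G\<^esub> ?A) \<inter> (g <#\<^bsub>G\<^esub> ?B) = g <#\<^bsub>G\<^esub> (?A \<inter> ?B)"
      using g subc by (auto simp: l_coset_def subset_iff)
    also have "\<dots> = {g, g \<otimes>\<^bsub>G\<^esub> s2}" using g by (auto simp: AB s2 l_coset_def)
    finally show ?thesis using g by (simp add: vertex edge adj_coset_hypermap del: One_nat_def)
  qed
  have lin: "x = y"
    if uv: "u \<in> vertex_of ?H ` carrier G" "v \<in> vertex_of ?H ` carrier G"
      and xy: "x \<in> edge_of ?H ` carrier G" "y \<in> edge_of ?H ` carrier G"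
      and ne: "u \<noteq> v" and i: "incident u x" "incident v x" "incident u y" "incident v y"
    for u v x y
  proof -
    obtain g h where u: "u = vertex_of ?H g" "g \<in> carrier G" and v: "v = vertex_of ?H h" "h \<in> carrier G"
      using uv by auto
    obtain k l where x: "x = edge_of ?H k" "k \<in> carrier G" and y: "y = edge_of ?H l" "l \<in> carrier G"
      using xy by auto
    obtain p q r t where p: "p \<in> u" "p \<in> x" and q: "q \<in> v" "q \<in> x" and r: "r \<in> u" "r \<in> y"
      and t: "t \<in> v" "t \<in> y"
      using i by (auto simp: incident_def)
    have c: "p \<in> carrier G" "q \<in> carrier G" "r \<in> carrier G" "t \<in> carrier G"
      using p q r t u v orbit_blades[OF H, of _ "{1, 2}"] by auto
    let ?m = "\<lambda>p q. inv\<^bsub>G\<^esub> p \<otimes>\<^bsub>G\<^esub> q"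
    \<comment> \<open>The corner \<open>t\<close> is reached from \<open>p\<close> through
      \<open>r\<close>, first inside \<open>u\<close> and then inside \<open>y\<close>, and through
      \<open>q\<close>, first inside \<open>x\<close> and then inside \<open>v\<close>. The two
      routes give the two factorizations of one quotient.\<close>
    have trans: "?m p r \<otimes>\<^bsub>G\<^esub> ?m r t = ?m p t" "?m p q \<otimes>\<^bsub>G\<^esub> ?m q t = ?m p t"
      using c by (simp_all add: m_assoc inv_solve_left' flip: m_assoc[of r "inv\<^bsub>G\<^esub> r" t] m_assoc[of q "inv\<^bsub>G\<^esub> q" t])
    have "?m p r \<in> ?A" "?m r t \<in> ?B" "?m p q \<in> ?B" "?m q t \<in> ?A"
      using p q r t u v x y vertex edge l_coset_meet_witness sub by metis+
    then have "?m p r \<otimes>\<^bsub>G\<^esub> ?m r t \<in> ?A <#>\<^bsub>G\<^esub> ?B" "?m p q \<otimes>\<^bsub>G\<^esub> ?m q t \<in> ?B <#>\<^bsub>G\<^esub> ?A"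
      unfolding set_mult_def by blast+
    then have "?m p t \<in> ?A <#>\<^bsub>G\<^esub> ?B" "?m p t \<in> ?B <#>\<^bsub>G\<^esub> ?A"
      unfolding trans .
    \<comment> \<open>In the first case \<open>t\<close> would lie in both \<open>u\<close> and
      \<open>v\<close>, which are distinct; in the second it lies in both \<open>x\<close> and
      \<open>y\<close>, which therefore coincide.\<close>
    then consider "?m p t \<in> ?A" | "?m p t \<in> ?B" using prod by blast
    then show ?thesis
    proof cases
      case 1
      then have "p \<otimes>\<^bsub>G\<^esub> ?m p t \<in> vertex_of ?H p" using c vertex by (auto simp: l_coset_def)
      then have "t \<in> vertex_of ?H p" using c by (simp flip: m_assoc)
      moreover have "vertex_of ?H p = u" using orbit_eq[OF H, of "{1, 2}" g p] u p by simp
      ultimately show ?thesis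
        using orbit_eq_iff_meet[OF H, of "{1, 2}" g h] u v t ne by auto
    next
      case 2
      then have "p \<otimes>\<^bsub>G\<^esub> ?m p t \<in> edge_of ?H p" using c edge by (auto simp: l_coset_def)
      then have "t \<in> edge_of ?H p" using c by (simp flip: m_assoc)
      moreover have "edge_of ?H p = x" using orbit_eq[OF H, of "{0, 2}" k p] x p by simp
      ultimately show ?thesis
        using orbit_eq_iff_meet[OF H, of "{0, 2}" k l] x y t by auto
    qed
  qed
  show ?thesis
    unfolding linear_hypermap_def blades_coset_hypermap
  proof (intro conjI ballI impI; (elim conjE)?)
    show "hypermap ?H" by (rule H)
  qed (rule no_loop inter lin; assumption)+
qed


section \<open>Regular polyhedra\<close>

text \<open>As \<open>adj M 0\<close> and \<open>adj M 2\<close> are commuting involutions on the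
  blades, these four are already closed under both.\<close>

lemma edge_of_surface_map:
  assumes M: "surface_map M" and b: "b \<in> blades M"
  shows "edge_of M b = {b, adj M 0 b, adj M 2 b, adj M 2 (adj M 0 b)}"
proof
  have H: "hypermap M" using M by (simp add: surface_map_def)
  have comm: "adj M 0 (adj M 2 c) = adj M 2 (adj M 0 c)" if "c \<in> blades M" for c
    using M that by (simp add: surface_map_def)
  show "edge_of M b \<subseteq> {b, adj M 0 b, adj M 2 b, adj M 2 (adj M 0 b)}"
    by (rule orbit_least)
      (use b in \<open>auto simp: hypermap_adj_adj[OF H] hypermap_adj_closed[OF H] comm\<close>)
  show "{b, adj M 0 b, adj M 2 b, adj M 2 (adj M 0 b)} \<subseteq> edge_of M b"
    using b by (auto intro!: orbit_step orbit_refl hypermap_adj_closed[OF H])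
qed

text \<open>Since \<open>adj M 2\<close> keeps the vertex, the four blades of an edge sit at only
  two vertices, which coincide for a loop.\<close>

lemma ends_edge_of:
  assumes M: "surface_map M" and b: "b \<in> blades M"
  shows "ends M (edge_of M b) = {vertex_of M b, vertex_of M (adj M 0 b)}"
proof -
  have H: "hypermap M" using M by (simp add: surface_map_def)
  have bl: "adj M 0 b \<in> blades M" using hypermap_adj_closed[OF H] b by simp
  have step: "adj M 2 c \<in> vertex_of M c" if "c \<in> blades M" for c
    using that by (intro orbit_step orbit_refl) auto
  have v: "vertex_of M c = vertex_of M d"
    if "c \<in> blades M" "d = c \<or> d = adj M 2 c" for c d
    using that orbit_eq[OF H, of "{1, 2}" c] step by auto
  have "incident (vertex_of M c) (edge_of M b) \<longleftrightarrow>
      vertex_of M c \<in> {vertex_of M b, vertex_of M (adj M 0 b)}" if c: "c \<in> blades M" for c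
  proof
    assume "incident (vertex_of M c) (edge_of M b)"
    then obtain d where d: "d \<in> vertex_of M c"
      "d \<in> {b, adj M 0 b, adj M 2 b, adj M 2 (adj M 0 b)}"
      by (auto simp: incident_def edge_of_surface_map[OF M b])
    moreover have "vertex_of M d = vertex_of M c" using d orbit_eq[OF H _ c] by simp
    ultimately show "vertex_of M c \<in> {vertex_of M b, vertex_of M (adj M 0 b)}"
      using v[OF b, of d] v[OF bl, of d] by auto
  next
    assume "vertex_of M c \<in> {vertex_of M b, vertex_of M (adj M 0 b)}"
    then have "b \<in> vertex_of M c \<or> adj M 0 b \<in> vertex_of M c" using orbit_refl by fastforce
    then show "incident (vertex_of M c) (edge_of M b)"
      by (auto simp: incident_def edge_of_surface_map[OF M b])
  qed
  then show ?thesis using b bl by (auto simp: ends_def)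
qed

section \<open>The group of a regular polyhedron acting on the blades\<close>

context
  fixes M :: "('b, 'z) flag_system_scheme" and G :: "('b \<Rightarrow> 'b) monoid"
    and r0 r1 r2 :: "'b \<Rightarrow> 'b" and b :: 'b
  assumes R: "regular_polyhedron M G r0 r1 r2 b"
begin

lemma polyhedron_surface_map: "surface_map M"
  and polyhedron_aut_group: "G = aut_group M"
  and polyhedron_base: "b \<in> blades M"
  and polyhedron_involution: "involution G r0" "involution G r1" "involution G r2"
  and polyhedron_generator: "r0 b = adj M 0 b" "r1 b = adj M 1 b" "r2 b = adj M 2 b"
  and polyhedron_generate: "generate G {r0, r1, r2} = carrier G"
  and polyhedron_vertex_stabilizer: "generate G {r1, r2} = cell_stabilizer G (vertex_of M b)"
  and polyhedron_edge_stabilizer: "generate G {r0, r2} = cell_stabilizer G (edge_of M b)"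
  and polyhedron_flags: "\<And>x y. x \<in> flags M \<Longrightarrow> y \<in> flags M \<Longrightarrow> \<exists>!g. g \<in> carrier G \<and> move_flag g x = y"
  using R unfolding regular_polyhedron_def by blast+

lemma polyhedron_hypermap: "hypermap M"
  using polyhedron_surface_map by (simp add: surface_map_def)

lemma polyhedron_group: "group G"
  using group_aut_group[OF polyhedron_hypermap] polyhedron_aut_group by simp

lemma polyhedron_generator_closed: "r0 \<in> carrier G" "r1 \<in> carrier G" "r2 \<in> carrier G"
  using polyhedron_involution by (auto simp: involution_def)

text \<open>Automorphisms commute with adjacencies, so
  \<open>g (r0 b) = g (adj M 0 b) = adj M 0 (g b)\<close>, and likewise for the others. Evaluation
  at \<open>b\<close> thus turns right multiplication in \<open>G\<close> into adjacency in
  \<open>M\<close>.\<close>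

lemma polyhedron_mult_generator:
  assumes "g \<in> carrier G"
  shows "(g \<otimes>\<^bsub>G\<^esub> r0) b = adj M 0 (g b)" "(g \<otimes>\<^bsub>G\<^esub> r1) b = adj M 1 (g b)"
    "(g \<otimes>\<^bsub>G\<^esub> r2) b = adj M 2 (g b)"
  using assms polyhedron_generator_closed polyhedron_base polyhedron_generator
  unfolding polyhedron_aut_group by (simp_all add: aut_group_mult_apply aut_group_adj)

text \<open>The values at \<open>b\<close> are closed under adjacency, hence exhaust the connected
  map; injectivity is freeness of the action.\<close>

lemma polyhedron_bij_blades: "bij_betw (\<lambda>g. g b) (carrier G) (blades M)"
proof -
  interpret group G by (rule polyhedron_group)
  note H = polyhedron_hypermap and b = polyhedron_base
  have "orbit M {0, 1, 2} b \<subseteq> (\<lambda>g. g b) ` carrier G"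
  proof (rule orbit_least)
    have "\<one>\<^bsub>G\<^esub> b = b" using b by (simp add: polyhedron_aut_group aut_group_one_apply)
    then show "b \<in> (\<lambda>g. g b) ` carrier G" by (metis imageI one_closed)
  next
    fix c i assume "c \<in> (\<lambda>g. g b) ` carrier G" and i: "i \<in> {0, 1, 2::nat}"
    then obtain g where g: "g \<in> carrier G" "c = g b" by blast
    have "\<exists>r. r \<in> carrier G \<and> (g \<otimes>\<^bsub>G\<^esub> r) b = adj M i (g b)"
      using i polyhedron_mult_generator[OF g(1)] polyhedron_generator_closed by blast
    then show "adj M i c \<in> (\<lambda>g. g b) ` carrier G"
      using g by (metis imageI m_closed)
  qed
  then have "blades M \<subseteq> (\<lambda>g. g b) ` carrier G" using H b by (simp add: hypermap_def)
  then show ?thesis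
    using aut_group_eqI[OF H _ _ b] aut_group_closed[OF _ b]
    by (auto simp: bij_betw_def inj_on_def polyhedron_aut_group)
qed

text \<open>If \<open>r1 = r2\<close>, then \<open>r2\<close> fixes the base flag: this is the only use of the regularity on flags.\<close>

lemma polyhedron_r1_neq_r2: "r1 \<noteq> r2"
proof
  assume eq: "r1 = r2"
  interpret group G by (rule polyhedron_group)
  note H = polyhedron_hypermap and b = polyhedron_base
  let ?x = "(vertex_of M b, edge_of M b, face_of M b)"
  have x: "?x \<in> flags M" using b orbit_refl[of b M] unfolding flags_def incident_def by blast
  have cell: "g ` orbit M I b = orbit M I (g b)" if "I \<subseteq> {0, 1, 2}" "g \<in> carrier G" for I g
    using aut_group_image_orbit[OF H _ _ b] that by (simp add: polyhedron_aut_group)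
  have gen: "r2 b = adj M 1 b" "r2 b = adj M 2 b" using polyhedron_generator eq by auto
  \<comment> \<open>Each of the three kinds of cell belongs to an index set containing 1 or 2, and
    \<open>r2 b\<close> is adjacent to \<open>b\<close> along both, so it lies in all three base
    cells.\<close>
  have "r2 b \<in> orbit M I b" if "1 \<in> I \<or> 2 \<in> I" for I
    using that gen orbit_step[OF orbit_refl b] by metis
  then have "orbit M I (r2 b) = orbit M I b" if "1 \<in> I \<or> 2 \<in> I" "I \<subseteq> {0, 1, 2}" for I
    using that orbit_eq[OF H _ b] by blast
  then have "move_flag r2 ?x = ?x"
    using cell polyhedron_generator_closed by (simp add: move_flag_def)
  moreover have "move_flag \<one>\<^bsub>G\<^esub> ?x = ?x"
    using cell[OF _ one_closed] b
    by (simp add: move_flag_def aut_group_one_apply[of b M, folded polyhedron_aut_group])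
  ultimately have "r2 = \<one>\<^bsub>G\<^esub>"
    using polyhedron_flags[OF x x] polyhedron_generator_closed one_closed by blast
  then show False using polyhedron_involution by (simp add: involution_def)
qed

section \<open>The conditions on the generators\<close>

text \<open>The absence of loops gives the intersection condition and \<open>r0 \<noteq> r1\<close>.
  The absence of parallel edges serves the product condition: an automorphism preserving the pair of
  ends of the base edge fixes that edge.\<close>

lemma polyhedron_regular_linear_conditions:
  assumes simple: "simple_graph M"
  shows "regular_linear_conditions G r0 r1 r2"
proof -
  interpret group G by (rule polyhedron_group)
  note M = polyhedron_surface_map and H = polyhedron_hypermap and b = polyhedron_base
    and rc = polyhedron_generator_closed
  let ?v = "vertex_of M b" and ?v' = "vertex_of M (adj M 0 b)" and ?e = "edge_of M b"
  let ?A = "generate G {r1, r2}" and ?B = "generate G {r0, r2}"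
  have b0: "adj M 0 b \<in> blades M" using hypermap_adj_closed[OF H _ b] by simp
  have cell: "g ` orbit M I c = orbit M I (g c)"
    if "I \<subseteq> {0, 1, 2}" "g \<in> carrier G" "c \<in> blades M" for I g c
    using aut_group_image_orbit[OF H] that by (simp add: polyhedron_aut_group)
  have adj_app: "g (adj M 0 c) = adj M 0 (g c)" if "g \<in> carrier G" "c \<in> blades M" for g c
    using aut_group_adj[of g M 0 c] that by (simp add: polyhedron_aut_group)
  have closed: "g c \<in> blades M" if "g \<in> carrier G" "c \<in> blades M" for g c
    using aut_group_closed that by (simp add: polyhedron_aut_group)
  have ends: "ends M ?e = {?v, ?v'}" by (rule ends_edge_of[OF M b])
  have "card (ends M ?e) = 2" using simple b by (simp add: simple_graph_def)
  then have neq: "?v \<noteq> ?v'" by (auto simp: ends)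
  have ends_image: "ends M (g ` ?e) = {g ` ?v, g ` ?v'}" if g: "g \<in> carrier G" for g
    using ends_edge_of[OF M closed[OF g b]] g b b0 by (simp add: cell adj_app)
  have edge_eq: "g ` ?e = ?e" if g: "g \<in> carrier G" and "{g ` ?v, g ` ?v'} = {?v, ?v'}" for g
  proof -
    have "ends M (g ` ?e) = ends M ?e" using that ends ends_image by simp
    moreover have "g ` ?e \<in> edges M" "?e \<in> edges M" using g b closed by (auto simp: cell)
    moreover have "inj_on (ends M) (edges M)" using simple by (simp add: simple_graph_def)
    ultimately show ?thesis by (metis inj_onD)
  qed
  have AC: "?A \<subseteq> carrier G" and BC: "?B \<subseteq> carrier G" using rc by (auto intro!: generate_incl)
  have A: "g \<in> ?A \<longleftrightarrow> g ` ?v = ?v" if "g \<in> carrier G" for g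
    using that by (simp add: polyhedron_vertex_stabilizer cell_stabilizer_def)
  have B: "g \<in> ?B \<longleftrightarrow> g ` ?e = ?e" if "g \<in> carrier G" for g
    using that by (simp add: polyhedron_edge_stabilizer cell_stabilizer_def)
  have sub: "subgroup ?A G" "subgroup ?B G" using rc by (auto intro: generate_is_subgroup)
  have B_ends: "{g ` ?v, g ` ?v'} = {?v, ?v'}" if g: "g \<in> ?B" for g
  proof -
    have gc: "g \<in> carrier G" using g BC by blast
    have "g ` ?e = ?e" using B[OF gc] g by simp
    then show ?thesis using ends_image[OF gc] ends by simp
  qed
  have sub_bl: "?v \<subseteq> blades M" "?v' \<subseteq> blades M"
    using orbit_blades[OF H b] orbit_blades[OF H b0] by auto
  have img_mult: "(g \<otimes>\<^bsub>G\<^esub> h) ` S = g ` h ` S"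
    if "g \<in> carrier G" "h \<in> carrier G" "S \<subseteq> blades M" for g h S
    using that unfolding image_image polyhedron_aut_group
    by (intro image_cong refl) (auto simp: aut_group_mult_apply)
  have img_one: "\<one>\<^bsub>G\<^esub> ` S = S" if "S \<subseteq> blades M" for S
  proof -
    have "\<one>\<^bsub>G\<^esub> ` S = id ` S"
      by (rule image_cong) (use that in \<open>auto simp: polyhedron_aut_group aut_group_one_apply\<close>)
    then show ?thesis by simp
  qed
  \<comment> \<open>The factor from \<open>?A\<close> acts first and fixes \<open>?v\<close>; the
    factor from \<open>?B\<close> then moves it within the ends of \<open>?e\<close>.\<close>
  have BA: "x ` ?v \<in> {?v, ?v'}" if x: "x \<in> ?B <#>\<^bsub>G\<^esub> ?A" for x
  proof -
    obtain g h where gh: "g \<in> ?B" "h \<in> ?A" "x = g \<otimes>\<^bsub>G\<^esub> h"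
      using x unfolding set_mult_def by blast
    then have "x ` ?v = g ` ?v"
      using img_mult[of g h ?v] A[of h] AC BC sub_bl by (metis subsetD)
    moreover have "g ` ?v \<in> {g ` ?v, g ` ?v'}" by simp
    ultimately show ?thesis unfolding B_ends[OF gh(1)] by simp
  qed
  have prod: "(?A <#>\<^bsub>G\<^esub> ?B) \<inter> (?B <#>\<^bsub>G\<^esub> ?A) = ?A \<union> ?B"
  proof
    have "K \<subseteq> K <#>\<^bsub>G\<^esub> L" "K \<subseteq> L <#>\<^bsub>G\<^esub> K"
      if K: "K \<subseteq> carrier G" and L: "\<one>\<^bsub>G\<^esub> \<in> L" for K L
    proof -
      have "x = x \<otimes>\<^bsub>G\<^esub> \<one>\<^bsub>G\<^esub>" "x = \<one>\<^bsub>G\<^esub> \<otimes>\<^bsub>G\<^esub> x" if "x \<in> K" for x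
        using K that by auto
      then show "K \<subseteq> K <#>\<^bsub>G\<^esub> L" "K \<subseteq> L <#>\<^bsub>G\<^esub> K"
        using L unfolding set_mult_def by blast+
    qed
    from this[OF AC generate.one] this[OF BC generate.one]
    show "?A \<union> ?B \<subseteq> (?A <#>\<^bsub>G\<^esub> ?B) \<inter> (?B <#>\<^bsub>G\<^esub> ?A)" by blast
    show "(?A <#>\<^bsub>G\<^esub> ?B) \<inter> (?B <#>\<^bsub>G\<^esub> ?A) \<subseteq> ?A \<union> ?B"
    proof
      fix x assume x: "x \<in> (?A <#>\<^bsub>G\<^esub> ?B) \<inter> (?B <#>\<^bsub>G\<^esub> ?A)"
      then have xc: "x \<in> carrier G" using set_mult_closed[OF AC BC] by blast
      \<comment> \<open>Inversion reverses the factors, so \<open>BA\<close> applies to the inverse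
        of \<open>x\<close> as well as to \<open>x\<close>.\<close>
      obtain g h where gh: "g \<in> ?A" "h \<in> ?B" "x = g \<otimes>\<^bsub>G\<^esub> h"
        using x unfolding set_mult_def by blast
      then have "inv\<^bsub>G\<^esub> x = inv\<^bsub>G\<^esub> h \<otimes>\<^bsub>G\<^esub> inv\<^bsub>G\<^esub> g"
        using AC BC inv_mult_group by blast
      moreover have "inv\<^bsub>G\<^esub> h \<in> ?B" "inv\<^bsub>G\<^esub> g \<in> ?A"
        using gh sub by (simp_all add: subgroup.m_inv_closed)
      ultimately have "inv\<^bsub>G\<^esub> x \<in> ?B <#>\<^bsub>G\<^esub> ?A"
        unfolding set_mult_def by blast
      then have i: "(inv\<^bsub>G\<^esub> x) ` ?v \<in> {?v, ?v'}" by (rule BA)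
      have xi: "x ` ((inv\<^bsub>G\<^esub> x) ` ?v) = ?v"
        using img_mult[of x "inv\<^bsub>G\<^esub> x" ?v] xc sub_bl img_one by simp
      have "x ` ?v \<in> {?v, ?v'}" using BA x by blast
      \<comment> \<open>If \<open>x\<close> moves \<open>?v\<close>, so does its inverse; both then
        send it to \<open>?v'\<close>, hence \<open>x\<close> swaps the ends.\<close>
      then consider "x ` ?v = ?v" | "x ` ?v = ?v'" "x ` ?v' = ?v"
        using i xi by auto
      then show "x \<in> ?A \<union> ?B"
        using A[OF xc] B[OF xc] edge_eq[OF xc] by cases auto
    qed
  qed
  have inter: "?A \<inter> ?B = generate G {r2}"
  proof
    show "generate G {r2} \<subseteq> ?A \<inter> ?B" by (intro Int_greatest mono_generate) auto
    show "?A \<inter> ?B \<subseteq> generate G {r2}"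
    proof
      fix g assume g: "g \<in> ?A \<inter> ?B"
      then have gc: "g \<in> carrier G" using AC by blast
      have "g ` ?v = ?v" "g ` ?e = ?e" using g A[OF gc] B[OF gc] by blast+
      \<comment> \<open>Of the four blades of \<open>?e\<close> available for \<open>g b\<close>,
        the two at \<open>?v'\<close> are excluded because \<open>g b\<close> lies in
        \<open>?v\<close>.\<close>
      then have "g b \<in> ?v" "g b \<in> ?e" using orbit_refl by (metis imageI)+
      moreover have "adj M 0 b \<notin> ?v" using neq orbit_eq[OF H _ b] by auto
      moreover have "adj M 2 (adj M 0 b) \<notin> ?v"
      proof
        assume "adj M 2 (adj M 0 b) \<in> ?v"
        moreover have "adj M 2 (adj M 0 b) \<in> ?v'" by (intro orbit_step orbit_refl b0) simp
        ultimately show False using neq orbit_eq_iff_meet[OF H _ b b0, of "{1, 2}"] by blast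
      qed
      ultimately have "g b = b \<or> g b = adj M 2 b"
        by (auto simp: edge_of_surface_map[OF M b])
      then have "g b = \<one>\<^bsub>G\<^esub> b \<or> g b = r2 b"
        using b polyhedron_generator by (simp add: polyhedron_aut_group aut_group_one_apply)
      then have "g = \<one>\<^bsub>G\<^esub> \<or> g = r2"
        using polyhedron_bij_blades gc rc by (auto simp: bij_betw_def dest: inj_onD)
      then show "g \<in> generate G {r2}" by (auto intro: generate.one generate.incl)
    qed
  qed
  \<comment> \<open>Otherwise \<open>adj M 0 b\<close> would equal \<open>adj M 1 b\<close>, and the
    base edge would be a loop.\<close>
  have "r0 \<noteq> r1"
  proof
    assume "r0 = r1"
    then have "adj M 0 b \<in> ?v"
      using polyhedron_generator orbit_step[OF orbit_refl b, of 1 "{1, 2}"] by simp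
    then show False using neq orbit_eq[OF H _ b] by auto
  qed
  moreover have "r0 \<noteq> r2" using M b polyhedron_generator by (auto simp: surface_map_def)
  moreover have "finite (carrier G)"
    using polyhedron_bij_blades H by (auto simp: hypermap_def bij_betw_finite)
  ultimately show ?thesis
    unfolding regular_linear_conditions_def
    using polyhedron_group polyhedron_involution polyhedron_generate polyhedron_r1_neq_r2 inter prod
    by blast
qed

section \<open>Isomorphisms onto the digon map and the medial map\<close>

text \<open>Evaluation at \<open>b\<close> identifies the coset hypermap with \<open>M\<close>, and
  the rules \<open>associated_adj\<close> and \<open>digon_adj\<close> differ only in the names of
  the two halves of a blade, which \<open>\<tau>\<close> translates.\<close>

lemma polyhedron_digon_iso:
  assumes lin: "linear_hypermap (coset_hypermap G r0 r1 r2)"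
  shows "digon_linear_hypermap M (coset_hypermap G r0 r1 r2)"
proof -
  let ?H = "coset_hypermap G r0 r1 r2"
  define \<phi> where "\<phi> = (\<lambda>g :: 'b \<Rightarrow> 'b. g b)"
  define \<tau> where "\<tau> = (\<lambda>t. case t of In_Hyperedge \<Rightarrow> In_Digon | In_Hyperface \<Rightarrow> In_Face)"
  let ?h = "map_prod \<phi> \<tau>"
  have H: "hypermap ?H" using lin by (simp add: linear_hypermap_def)
  have bij: "bij_betw \<phi> (carrier G) (blades M)"
    unfolding \<phi>_def by (rule polyhedron_bij_blades)
  have "bij_betw \<tau> UNIV UNIV"
    by (rule bij_betw_byWitness[where f' = "\<lambda>t. case t of In_Digon \<Rightarrow> In_Hyperedge | In_Face \<Rightarrow> In_Hyperface"])
      (auto simp: \<tau>_def split: cell_side.splits digon_side.splits)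
  then have "bij_betw ?h (carrier G \<times> UNIV) (blades M \<times> UNIV)"
    using bij by (intro bij_betw_map_prod)
  moreover have \<phi>: "\<phi> (adj ?H i g) = adj M i (\<phi> g)" if "i \<in> {0, 1, 2}" "g \<in> carrier G" for i g
    using that polyhedron_mult_generator by (auto simp: \<phi>_def adj_coset_hypermap)
  moreover have "?h (associated_adj ?H i (g, t)) = digon_adj M i (?h (g, t))"
    if "i \<in> {0, 1, 2}" "g \<in> carrier G" for i g t
    using that \<phi> by (cases t) (auto simp: \<tau>_def)
  ultimately have iso: "is_iso (associated_map ?H) (digon_map M) ?h"
    by (auto simp: is_iso_def associated_map_def digon_map_def simp del: map_prod_simp)
  \<comment> \<open>Stated for whole families of cells, so that the index sets \<open>{0, 2}\<close>
    and \<open>{0, 1}\<close> give the hyperedges and the hyperfaces.\<close>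
  have cells: "(`) \<phi> ` orbit ?H I ` carrier G = orbit M I ` blades M" if I: "I \<subseteq> {0, 1, 2}" for I
  proof -
    have "\<phi> ` orbit ?H I g = orbit M (id ` I) (\<phi> g)" if "g \<in> carrier G" for g
      using that I \<phi> bij hypermap_adj_closed[OF H]
      by (intro image_orbit) (auto simp: bij_betw_def)
    then have "(`) \<phi> ` orbit ?H I ` carrier G = orbit M I ` \<phi> ` carrier G"
      by (simp add: image_image)
    then show ?thesis using bij by (simp add: bij_betw_def)
  qed
  have img: "{?h ` (x \<times> {t}) | x. x \<in> S} = {e \<times> {\<tau> t} | e. e \<in> (`) \<phi> ` S}" for t S
  proof -
    have "?h ` (x \<times> {t}) = (\<phi> ` x) \<times> {\<tau> t}" for x by auto
    then show ?thesis by (auto simp: image_image)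
  qed
  show ?thesis
    unfolding digon_linear_hypermap_def
    using lin iso img[of In_Hyperedge] img[of In_Hyperface] cells[of "{0, 2}"] cells[of "{0, 1}"]
    by (intro conjI exI[of _ ?h]) (simp_all add: \<tau>_def)
qed

text \<open>Here evaluation at \<open>b\<close> carries the adjacencies 0 and 1 of the hypermap to 1
  and 0 of \<open>M\<close>; after this exchange the rule \<open>associated_adj\<close> becomes
  \<open>medial_adj\<close>.\<close>

lemma polyhedron_medial_iso:
  assumes lin: "linear_hypermap (coset_hypermap G r1 r0 r2)"
  shows "medial_linear_hypermap M (coset_hypermap G r1 r0 r2)"
proof -
  let ?H = "coset_hypermap G r1 r0 r2"
  define \<phi> where "\<phi> = (\<lambda>g :: 'b \<Rightarrow> 'b. g b)"
  define \<sigma> :: "nat \<Rightarrow> nat" where "\<sigma> = id(0 := 1, 1 := 0)"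
  define \<tau> where "\<tau> = (\<lambda>t. case t of In_Hyperedge \<Rightarrow> Near_Vertex | In_Hyperface \<Rightarrow> Near_Face)"
  let ?h = "map_prod \<phi> \<tau>"
  have H: "hypermap ?H" using lin by (simp add: linear_hypermap_def)
  have bij: "bij_betw \<phi> (carrier G) (blades M)"
    unfolding \<phi>_def by (rule polyhedron_bij_blades)
  have "bij_betw \<tau> UNIV UNIV"
    by (rule bij_betw_byWitness[where f' = "\<lambda>t. case t of Near_Vertex \<Rightarrow> In_Hyperedge | Near_Face \<Rightarrow> In_Hyperface"])
      (auto simp: \<tau>_def split: cell_side.splits medial_side.splits)
  then have "bij_betw ?h (carrier G \<times> UNIV) (blades M \<times> UNIV)"
    using bij by (intro bij_betw_map_prod)
  moreover have \<phi>: "\<phi> (adj ?H i g) = adj M (\<sigma> i) (\<phi> g)" if "i \<in> {0, 1, 2}" "g \<in> carrier G" for i g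
    using that polyhedron_mult_generator by (auto simp: \<phi>_def \<sigma>_def adj_coset_hypermap)
  moreover have "?h (associated_adj ?H i (g, t)) = medial_adj M i (?h (g, t))"
    if "i \<in> {0, 1, 2}" "g \<in> carrier G" for i g t
    using that \<phi> by (cases t) (auto simp: \<tau>_def \<sigma>_def)
  ultimately have iso: "is_iso (associated_map ?H) (medial_map M) ?h"
    by (auto simp: is_iso_def associated_map_def medial_map_def simp del: map_prod_simp)
  have cells: "(`) \<phi> ` orbit ?H I ` carrier G = orbit M (\<sigma> ` I) ` blades M"
    if I: "I \<subseteq> {0, 1, 2}" for I
  proof -
    have "\<phi> ` orbit ?H I g = orbit M (\<sigma> ` I) (\<phi> g)" if "g \<in> carrier G" for g
      using that I \<phi> bij hypermap_adj_closed[OF H]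
      by (intro image_orbit) (auto simp: bij_betw_def)
    then have "(`) \<phi> ` orbit ?H I ` carrier G = orbit M (\<sigma> ` I) ` \<phi> ` carrier G"
      by (simp add: image_image)
    then show ?thesis using bij by (simp add: bij_betw_def)
  qed
  \<comment> \<open>Consequently hyperedges correspond to vertices of \<open>M\<close>, while
    hyperfaces still correspond to faces.\<close>
  have \<sigma>: "\<sigma> ` {0, 2} = {1, 2}" "\<sigma> ` {0, 1} = {0, 1}" by (auto simp: \<sigma>_def)
  have img: "{?h ` (x \<times> {t}) | x. x \<in> S} = {e \<times> {\<tau> t} | e. e \<in> (`) \<phi> ` S}" for t S
  proof -
    have "?h ` (x \<times> {t}) = (\<phi> ` x) \<times> {\<tau> t}" for x by auto
    then show ?thesis by (auto simp: image_image)
  qed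
  show ?thesis
    unfolding medial_linear_hypermap_def
    using lin iso img[of In_Hyperedge] img[of In_Hyperface] cells[of "{0, 2}"] cells[of "{0, 1}"]
    by (intro conjI exI[of _ ?h]) (simp_all only: \<sigma> \<tau>_def, simp_all)
qed

end

theorem theorem4p8:
  fixes M :: "'b flag_system" and G :: "('b \<Rightarrow> 'b) monoid"
    and r0 r1 r2 :: "'b \<Rightarrow> 'b" and b :: 'b
  assumes "regular_polyhedron M G r0 r1 r2 b"
    and "simple_graph M"
  shows "(regular_linear_conditions G r0 r1 r2 \<and>
          regular_hypermap (coset_hypermap G r0 r1 r2) \<and>
          digon_linear_hypermap M (coset_hypermap G r0 r1 r2)) \<and>
         (regular_linear_conditions G r1 r0 r2 \<and>
          regular_hypermap (coset_hypermap G r1 r0 r2) \<and>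
          medial_linear_hypermap M (coset_hypermap G r1 r0 r2))"
proof -
  have C: "regular_linear_conditions G r0 r1 r2"
    using assms by (rule polyhedron_regular_linear_conditions)
  note C' = regular_linear_conditions_swap[OF C]
  show ?thesis
    using C C' regular_hypermap_coset_hypermap[OF C] regular_hypermap_coset_hypermap[OF C']
      polyhedron_digon_iso[OF assms(1) linear_hypermap_coset_hypermap[OF C]]
      polyhedron_medial_iso[OF assms(1) linear_hypermap_coset_hypermap[OF C']]
    by blast
qed

end
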